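(* Let $|\phi|<1$, $|\rho|<1$, $\sigma_\xi>0$, and let $(Y_t)_{t\ge 0}$ be a Markov DIG-AR(1) process with parameters $\phi,\rho,\sigma_\xi$. Then for every integer $k\ge 1$, the $k$-th order autocorrelation $\mathrm{corr}(Y_t,Y_{t+k})$ satisfies $$\mathrm{corr}(Y_t,Y_{t+k})\longrightarrow\left(\phi+\frac{\rho\,\sigma_\xi}{\bar V(\rho,\phi)}\right)^k\quad\text{as } t\to+\infty,$$ where $$\bar V(\rho,\phi)=\frac{\sigma_\xi\left(\rho\phi+\sqrt{\rho^2\phi^2+1-\phi^2}\right)}{1-\phi^2}.$$
   Context: A dependent innovations gaussian AR(1) process (DIG-AR(1)) with parameters $\phi,\rho,\sigma_\xi$ ($|\phi|<1$, $|\rho|<1$, $\sigma_\xi>0$) is a discrete-time real stochastic process on a probability space, $Y_t=\phi Y_{t-1}+\xi_t$ for $t\ge 1$, where $Y_0=0$ a.s., the $\xi_t$ are identically distributed (not assumed independent) with $\xi_t\sim N(0,\sigma_\xi^2)$ (variance $\sigma_\xi^2$), and for every $t$ the copula associated with $(\xi_t,Y_{t-1})$ is the gaussian copula with time-invariant parameter (correlation) $\rho$. For $t=1$ the copula condition is no restriction because $Y_0$ is constant. It is called a Markov DIG-AR(1) process if moreover $(Y_t)_t$ is a Markov process with respect to its own filtration. *)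

theory Defs
  imports "HOL-Probability.Probability"
begin

definition std_normal_cdf :: "real \<Rightarrow> real" where
  "std_normal_cdf = cdf std_normal_distribution"

text \<open>The generalised inverse of the standard normal distribution function; being valued in the
  extended reals, it takes the values \<open>-\<infinity>\<close> at \<open>0\<close> and \<open>\<infinity>\<close> at \<open>1\<close>.\<close>

definition std_normal_quantile :: "real \<Rightarrow> ereal" where
  "std_normal_quantile u = Inf {ereal x | x. u \<le> std_normal_cdf x}"

definition bivariate_normal_density :: "real \<Rightarrow> real \<times> real \<Rightarrow> real" where
  "bivariate_normal_density \<rho> = (\<lambda>(x, y).
     exp (- (x\<^sup>2 - 2 * \<rho> * x * y + y\<^sup>2) / (2 * (1 - \<rho>\<^sup>2))) / (2 * pi * sqrt (1 - \<rho>\<^sup>2)))"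

definition bivariate_normal_cdf :: "real \<Rightarrow> ereal \<Rightarrow> ereal \<Rightarrow> real" where
  "bivariate_normal_cdf \<rho> a b =
     measure (density lborel (\<lambda>p. ennreal (bivariate_normal_density \<rho> p)))
       {(x, y). ereal x \<le> a \<and> ereal y \<le> b}"

definition gaussian_copula :: "real \<Rightarrow> real \<Rightarrow> real \<Rightarrow> real" where
  "gaussian_copula \<rho> u v =
     bivariate_normal_cdf \<rho> (std_normal_quantile u) (std_normal_quantile v)"

text \<open>Sklar's relation between a joint distribution function and its margins. The margins need not
  be continuous, in which case only the values of \<open>C\<close> on the ranges of the marginal distribution
  functions matter; if one of the variables is almost surely constant, every copula \<open>C\<close> qualifies.\<close>

definition has_copula ::
  "'a measure \<Rightarrow> ('a \<Rightarrow> real) \<Rightarrow> ('a \<Rightarrow> real) \<Rightarrow> (real \<Rightarrow> real \<Rightarrow> real) \<Rightarrow> bool" where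
  "has_copula M X Y C \<longleftrightarrow>
     (\<forall>x y. measure M {\<omega> \<in> space M. X \<omega> \<le> x \<and> Y \<omega> \<le> y} =
        C (cdf (distr M borel X) x) (cdf (distr M borel Y) y))"

definition own_filtration :: "'a measure \<Rightarrow> (nat \<Rightarrow> 'a \<Rightarrow> real) \<Rightarrow> nat \<Rightarrow> 'a measure" where
  "own_filtration M Y t =
     sigma (space M) (\<Union>s\<le>t. {Y s -` A \<inter> space M | A. A \<in> sets borel})"

definition markov_process :: "'a measure \<Rightarrow> (nat \<Rightarrow> 'a \<Rightarrow> real) \<Rightarrow> bool" where
  "markov_process M Y \<longleftrightarrow>
     (\<forall>s t. \<forall>A \<in> sets borel. s \<le> t \<longrightarrow>
        (AE \<omega> in M.
           real_cond_exp M (own_filtration M Y s) (indicator (Y t -` A \<inter> space M)) \<omega> =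
           real_cond_exp M (vimage_algebra (space M) (Y s) borel)
             (indicator (Y t -` A \<inter> space M)) \<omega>))"

definition (in prob_space) covariance :: "('a \<Rightarrow> real) \<Rightarrow> ('a \<Rightarrow> real) \<Rightarrow> real" where
  "covariance X Y = expectation (\<lambda>\<omega>. (X \<omega> - expectation X) * (Y \<omega> - expectation Y))"

definition (in prob_space) correlation :: "('a \<Rightarrow> real) \<Rightarrow> ('a \<Rightarrow> real) \<Rightarrow> real" where
  "correlation X Y = covariance X Y / (sqrt (variance X) * sqrt (variance Y))"

text \<open>The variable \<open>\<xi> 0\<close> plays no role and is left unconstrained.\<close>

locale dig_ar1 = prob_space M for M :: "'a measure" +
  fixes \<phi> \<rho> \<sigma> :: real and Y \<xi> :: "nat \<Rightarrow> 'a \<Rightarrow> real"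
  assumes abs_phi_less_1: "\<bar>\<phi>\<bar> < 1"
    and abs_rho_less_1: "\<bar>\<rho>\<bar> < 1"
    and sigma_pos: "\<sigma> > 0"
    and random_variable_Y: "\<And>t. random_variable borel (Y t)"
    and Y_0: "AE \<omega> in M. Y 0 \<omega> = 0"
    and Y_rec: "\<And>t. t \<ge> 1 \<Longrightarrow> AE \<omega> in M. Y t \<omega> = \<phi> * Y (t - 1) \<omega> + \<xi> t \<omega>"
    and innovation_distr: "\<And>t. t \<ge> 1 \<Longrightarrow> distributed M lborel (\<xi> t) (normal_density 0 \<sigma>)"
    and innovation_copula: "\<And>t. t \<ge> 1 \<Longrightarrow> has_copula M (\<xi> t) (Y (t - 1)) (gaussian_copula \<rho>)"

locale markov_dig_ar1 = dig_ar1 +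
  assumes markov: "markov_process M Y"

definition V_bar :: "real \<Rightarrow> real \<Rightarrow> real \<Rightarrow> real" where
  "V_bar \<sigma> \<rho> \<phi> = \<sigma> * (\<rho> * \<phi> + sqrt (\<rho>\<^sup>2 * \<phi>\<^sup>2 + 1 - \<phi>\<^sup>2)) / (1 - \<phi>\<^sup>2)"

end

theory Submission
  imports Defs
begin

text \<open>The argument is the elementary one for Gaussian autoregressions, once the dependent innovation
  has been turned into an independent one.

  If \<open>Y\<^bsub>t\<^esub>\<close> is \<open>N(0, \<tau>\<^sup>2)\<close> with \<open>\<tau> > 0\<close>, then both margins of \<open>(\<xi>\<^bsub>t+1\<^esub>, Y\<^bsub>t\<^esub>)\<close> are normal, so the Gaussian copula says
  precisely that the pair is bivariate normal with correlation \<open>\<rho>\<close>. Hence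
  \<open>\<xi>\<^bsub>t+1\<^esub> = (\<rho> \<sigma> / \<tau>) Y\<^bsub>t\<^esub> + \<sigma> sqrt (1 - \<rho>\<^sup>2) Z\<close> with \<open>Z\<close> standard normal and independent of \<open>Y\<^bsub>t\<^esub>\<close>
  (\<open>gaussian_copula_regression\<close>). Two things follow (\<open>transition\<close>): \<open>Y\<^bsub>t+1\<^esub>\<close> is again centred normal,
  with standard deviation \<open>next_sd \<phi> \<rho> \<sigma> \<tau>\<close>, and \<open>E[Y\<^bsub>t+1\<^esub> | Y\<^bsub>t\<^esub>] = (\<phi> + \<rho> \<sigma> / \<tau>) Y\<^bsub>t\<^esub>\<close>.
  As \<open>Y\<^bsub>1\<^esub> = \<xi>\<^bsub>1\<^esub>\<close> almost surely, both hold at every time \<open>t \<ge> 1\<close>.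

  By the Markov property the past may replace \<open>Y\<^bsub>t\<^esub>\<close> in that conditional expectation, so each further
  time step multiplies \<open>E[Y\<^bsub>t\<^esub> Y\<^bsub>t+k\<^esub>]\<close> by the current regression coefficient
  (\<open>expectation_mult_markov\<close>, \<open>expectation_product\<close>). The correlation is therefore a product of \<open>k\<close>
  such coefficients times a quotient of two standard deviations (\<open>correlation_Y\<close>).

  Finally \<open>next_sd \<phi> \<rho> \<sigma>\<close> is Lipschitz with constant \<open>\<bar>\<phi>\<bar> < 1\<close> and fixes \<open>V_bar \<sigma> \<rho> \<phi>\<close>, so the standard
  deviations converge to \<open>V_bar \<sigma> \<rho> \<phi>\<close>; the quotient tends to \<open>1\<close> and each coefficient to
  \<open>\<phi> + \<rho> \<sigma> / V_bar \<sigma> \<rho> \<phi>\<close>.\<close>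

section \<open>Normal distribution functions and quantiles\<close>

text \<open>The standard normal density is positive, so it gives every nondegenerate interval positive mass.\<close>
lemma cdf_std_normal_strict_mono: "strict_mono std_normal_cdf"
proof (rule strict_monoI)
  fix x z :: real assume xz: "x < z"
  interpret real_distribution std_normal_distribution by (rule real_dist_normal_dist)
  have eq: "std_normal_cdf z - std_normal_cdf x = measure std_normal_distribution {x<..z}"
    unfolding std_normal_cdf_def using cdf_diff_eq[OF xz] .
  have "measure std_normal_distribution {x<..z} \<noteq> 0"
  proof
    assume "measure std_normal_distribution {x<..z} = 0"
    then have "emeasure std_normal_distribution {x<..z} = 0"
      by (simp add: emeasure_eq_measure)
    then have "{x<..z} \<in> null_sets std_normal_distribution" by auto
    then have "AE y in lborel. y \<in> {x<..z} \<longrightarrow> ennreal (std_normal_density y) = 0"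
      by (subst (asm) null_sets_density_iff) auto
    then have "AE y in lborel. y \<notin> {x<..z}"
      by eventually_elim (use normal_density_pos[of 1 0] in \<open>auto simp: ennreal_eq_0_iff not_le[symmetric] simp del: not_le\<close>)
    then have "{x<..z} \<in> null_sets lborel"
      by (subst AE_iff_null_sets) auto
    then show False using xz by (simp add: null_sets_def ennreal_eq_0_iff)
  qed
  then show "std_normal_cdf x < std_normal_cdf z"
    using eq measure_nonneg[of std_normal_distribution "{x<..z}"] by linarith
qed

text \<open>Strict monotonicity makes the generalised inverse a genuine left inverse of the distribution
  function; the infinite quantiles at \<open>0\<close> and \<open>1\<close> are never reached.\<close>
lemma std_normal_quantile_cdf: "std_normal_quantile (std_normal_cdf x) = ereal x"
proof -
  have "{ereal z | z. std_normal_cdf x \<le> std_normal_cdf z} = ereal ` {x..}"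
    using strict_mono_less_eq[OF cdf_std_normal_strict_mono] by auto
  moreover have "Inf (ereal ` {x..}) = ereal x"
    by (rule Inf_eqI) auto
  ultimately show ?thesis unfolding std_normal_quantile_def by simp
qed

lemma (in prob_space) distributed_normal_scaled:
  assumes "0 < \<tau>" "distributed M lborel X (normal_density 0 \<tau>)"
  shows "distributed M lborel (\<lambda>\<omega>. X \<omega> / \<tau>) std_normal_density"
  using assms normal_standard_normal_convert[of \<tau> X 0] by simp

lemma (in prob_space) distributed_lborel_measurable:
  "distributed M lborel X f \<Longrightarrow> random_variable borel X"
  using distributed_measurable[of M lborel X f] by simp

lemma (in prob_space) distributed_lborel_distr:
  "distributed M lborel X f \<Longrightarrow> distr M borel X = density lborel f"
  using distributed_distr_eq_density[of M lborel X f] by (metis distr_cong sets_lborel)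

lemma (in prob_space) cdf_normal:
  assumes "0 < \<tau>" "distributed M lborel X (normal_density 0 \<tau>)"
  shows "cdf (distr M borel X) x = std_normal_cdf (x / \<tau>)"
proof -
  note S = distributed_normal_scaled[OF assms]
  note [measurable] = distributed_lborel_measurable[OF assms(2)] distributed_lborel_measurable[OF S]
  have "cdf (distr M borel X) x = prob (X -` {..x} \<inter> space M)"
    unfolding cdf_def by (simp add: measure_distr)
  also have "X -` {..x} \<inter> space M = (\<lambda>\<omega>. X \<omega> / \<tau>) -` {..x / \<tau>} \<inter> space M"
    using assms(1) by (auto simp: divide_le_cancel)
  also have "prob \<dots> = cdf (distr M borel (\<lambda>\<omega>. X \<omega> / \<tau>)) (x / \<tau>)"
    unfolding cdf_def by (simp add: measure_distr)
  finally show ?thesis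
    unfolding std_normal_cdf_def distributed_lborel_distr[OF S] .
qed

section \<open>The bivariate normal law\<close>

text \<open>Completing the square in the exponent: given the second coordinate \<open>y\<close>, the first one is
  normal with mean \<open>\<rho> y\<close> and variance \<open>1 - \<rho>\<^sup>2\<close>.\<close>
lemma bivariate_normal_density_factor:
  assumes "\<bar>\<rho>\<bar> < 1"
  shows "bivariate_normal_density \<rho> (x, y) =
    std_normal_density y * normal_density (\<rho> * y) (sqrt (1 - \<rho>\<^sup>2)) x"
proof -
  have pos: "0 < 1 - \<rho>\<^sup>2" using assms by (simp add: abs_square_less_1)
  have "- (x\<^sup>2 - 2 * \<rho> * x * y + y\<^sup>2) / (2 * (1 - \<rho>\<^sup>2)) =
      - y\<^sup>2 / 2 + - (x - \<rho> * y)\<^sup>2 / (2 * (1 - \<rho>\<^sup>2))"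
  proof -
    have "x\<^sup>2 - 2 * \<rho> * x * y + y\<^sup>2 = y\<^sup>2 * (1 - \<rho>\<^sup>2) + (x - \<rho> * y)\<^sup>2"
      by (simp add: power2_eq_square algebra_simps)
    moreover have "- (a * r + b) / (2 * r) = - a / 2 + - b / (2 * r)" if "0 < r" for a b r :: real
      using that by (simp add: field_simps)
    ultimately show ?thesis using pos by metis
  qed
  moreover have "2 * pi * sqrt (1 - \<rho>\<^sup>2) = sqrt (2 * pi) * sqrt (2 * pi * (1 - \<rho>\<^sup>2))"
    using real_sqrt_mult[of "2 * pi" "1 - \<rho>\<^sup>2"] by (simp del: real_sqrt_mult)
  ultimately show ?thesis
    using pos by (simp add: bivariate_normal_density_def normal_density_def mult_exp_exp)
qed

lemma borel_measurable_bivariate_normal_density [measurable]: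
  "bivariate_normal_density \<rho> \<in> borel_measurable borel"
  unfolding bivariate_normal_density_def borel_prod[symmetric] by measurable

lemma normal_density_rescale:
  assumes "0 < s"
  shows "s * normal_density m s (m + s * z) = std_normal_density z"
  using assms by (simp add: normal_density_def real_sqrt_mult power_mult_distrib)

text \<open>The probabilistic form of the factorisation: substituting \<open>x = \<rho> u + sqrt (1 - \<rho>\<^sup>2) z\<close> in the
  inner integral turns the conditional density into a standard normal density in \<open>z\<close>. In particular
  the bivariate normal density has total mass one.\<close>
lemma bivariate_normal_eq_distr:
  assumes \<rho>: "\<bar>\<rho>\<bar> < 1"
  shows "density lborel (bivariate_normal_density \<rho>) =
    distr (std_normal_distribution \<Otimes>\<^sub>M std_normal_distribution) borel
      (\<lambda>(u, z). (\<rho> * u + sqrt (1 - \<rho>\<^sup>2) * z, u))" (is "?L = distr (?N \<Otimes>\<^sub>M ?N) borel ?T")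
proof (rule measure_eqI)
  let ?s = "sqrt (1 - \<rho>\<^sup>2)"
  have s: "0 < ?s" using \<rho> by (simp add: abs_square_less_1)
  interpret N: prob_space ?N by (rule prob_space_normal_density) simp
  fix A assume "A \<in> sets ?L"
  then have A[measurable]: "A \<in> sets (borel \<Otimes>\<^sub>M borel)" unfolding borel_prod by simp
  then have A'[measurable]: "A \<in> sets borel" unfolding borel_prod .
  have T[measurable]: "?T \<in> ?N \<Otimes>\<^sub>M ?N \<rightarrow>\<^sub>M borel"
    unfolding borel_prod[symmetric] by measurable
  have "emeasure ?L A = (\<integral>\<^sup>+p. ennreal (bivariate_normal_density \<rho> p) * indicator A p \<partial>(lborel \<Otimes>\<^sub>M lborel))"
    by (simp add: emeasure_density lborel_prod)
  also have "\<dots> = (\<integral>\<^sup>+y. \<integral>\<^sup>+x. ennreal (bivariate_normal_density \<rho> (x, y)) * indicator A (x, y) \<partial>lborel \<partial>lborel)"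
    by (rule lborel_pair.nn_integral_snd[symmetric]) (simp add: lborel_prod)
  also have "\<dots> = (\<integral>\<^sup>+y. ennreal (std_normal_density y) * (\<integral>\<^sup>+z. ennreal (std_normal_density z) * indicator A (?T (y, z)) \<partial>lborel) \<partial>lborel)"
  proof (rule nn_integral_cong)
    fix y :: real
    have sub: "ennreal ?s * (ennreal (normal_density (\<rho> * y) ?s (\<rho> * y + ?s * z)) * i) = ennreal (std_normal_density z) * i"
      for z i
    proof -
      have "?s * normal_density (\<rho> * y) ?s (\<rho> * y + ?s * z) = std_normal_density z"
        by (rule normal_density_rescale[OF s])
      then have "ennreal ?s * ennreal (normal_density (\<rho> * y) ?s (\<rho> * y + ?s * z)) = ennreal (std_normal_density z)"
        using s by (metis ennreal_mult less_imp_le normal_density_nonneg)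
      then show ?thesis by (metis mult.assoc)
    qed
    have "(\<integral>\<^sup>+x. ennreal (bivariate_normal_density \<rho> (x, y)) * indicator A (x, y) \<partial>lborel) =
      (\<integral>\<^sup>+x. ennreal (std_normal_density y) * (ennreal (normal_density (\<rho> * y) ?s x) * indicator A (x, y)) \<partial>lborel)"
      by (simp add: bivariate_normal_density_factor[OF \<rho>] ennreal_mult mult.assoc)
    also have "\<dots> = ennreal (std_normal_density y) * (\<integral>\<^sup>+x. (ennreal (normal_density (\<rho> * y) ?s x) * indicator A (x, y)) \<partial>lborel)"
      by (rule nn_integral_cmult) measurable
    also have "(\<integral>\<^sup>+x. (ennreal (normal_density (\<rho> * y) ?s x) * indicator A (x, y)) \<partial>lborel) =
      ennreal \<bar>?s\<bar> * (\<integral>\<^sup>+z. (ennreal (normal_density (\<rho> * y) ?s (\<rho> * y + ?s * z)) * indicator A (\<rho> * y + ?s * z, y)) \<partial>lborel)"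
    proof (rule nn_integral_real_affine)
      show "(\<lambda>x. ennreal (normal_density (\<rho> * y) ?s x) * indicator A (x, y)) \<in> borel_measurable borel"
        by measurable
      show "?s \<noteq> 0" using s by simp
    qed
    also have "\<dots> = (\<integral>\<^sup>+z. ennreal (std_normal_density z) * indicator A (\<rho> * y + ?s * z, y) \<partial>lborel)"
      using s by (subst nn_integral_cmult[symmetric]) (measurable, simp add: sub)
    finally show "(\<integral>\<^sup>+x. ennreal (bivariate_normal_density \<rho> (x, y)) * indicator A (x, y) \<partial>lborel) =
      ennreal (std_normal_density y) * (\<integral>\<^sup>+z. ennreal (std_normal_density z) * indicator A (?T (y, z)) \<partial>lborel)"
      by simp
  qed
  also have "\<dots> = (\<integral>\<^sup>+y. (\<integral>\<^sup>+z. indicator A (?T (y, z)) \<partial>?N) \<partial>?N)"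
    by (simp add: nn_integral_density)
  also have "\<dots> = (\<integral>\<^sup>+p. indicator A (?T p) \<partial>(?N \<Otimes>\<^sub>M ?N))"
    by (rule N.nn_integral_fst) measurable
  also have "\<dots> = emeasure (distr (?N \<Otimes>\<^sub>M ?N) borel ?T) A"
    using nn_integral_distr[OF T, of "indicator A"] by simp
  finally show "emeasure ?L A = emeasure (distr (?N \<Otimes>\<^sub>M ?N) borel ?T) A" .
qed simp

text \<open>The lower orthants are closed under intersection and generate the Borel sets, so a finite
  measure is determined by its joint distribution function.\<close>
lemma finite_measure_eqI_atMost:
  fixes M N :: "'b::ordered_euclidean_space measure"
  assumes "finite_measure M" "finite_measure N" and [simp]: "sets M = sets borel" "sets N = sets borel"
    and eq: "\<And>a. measure M {..a} = measure N {..a}"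
  shows "M = N"
proof (rule measure_eqI_generator_eq)
  interpret M: finite_measure M by fact
  interpret N: finite_measure N by fact
  let ?E = "range (\<lambda>a::'b. {..a})"
  have "{..a} \<inter> {..b} = {..inf a b}" for a b :: 'b by auto
  then show "Int_stable ?E" by (auto simp: Int_stable_def)
  show "?E \<subseteq> Pow UNIV" by simp
  show "emeasure M X = emeasure N X" if "X \<in> ?E" for X
    using that eq by (auto simp: M.emeasure_eq_measure N.emeasure_eq_measure)
  have "sets (borel :: 'b measure) = sigma_sets UNIV ?E"
    by (subst borel_eq_atMost) (simp add: sets_measure_of)
  then show "sets M = sigma_sets UNIV ?E" "sets N = sigma_sets UNIV ?E" by simp_all
  let ?A = "\<lambda>n::nat. {..real n *\<^sub>R (\<Sum>Basis :: 'b)}"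
  show "range ?A \<subseteq> ?E" by auto
  show "(\<Union>n. ?A n) = UNIV"
  proof -
    have "\<exists>n. x \<in> ?A n" for x :: 'b
    proof -
      obtain n where n: "norm x \<le> real n" using real_arch_simple by blast
      have "x \<bullet> b \<le> real n * ((\<Sum>Basis) \<bullet> b)" if "b \<in> Basis" for b
        using Basis_le_norm[OF that, of x] n that by (simp add: inner_sum_Basis)
      then show ?thesis by (auto simp: eucl_le[where 'a='b])
    qed
    then show ?thesis by auto
  qed
  show "emeasure M (?A n) \<noteq> \<infinity>" for n by simp
qed

section \<open>From the Gaussian copula to a linear regression\<close>

context prob_space
begin

text \<open>With normal margins, the arguments of the copula in Sklar's relation run through the values of
  the standard normal distribution function, where the quantiles cancel it. The joint distribution
  function of the standardised pair is thus the bivariate normal one.\<close>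
lemma standardised_joint_distr:
  assumes \<rho>: "\<bar>\<rho>\<bar> < 1" and \<sigma>: "0 < \<sigma>" and \<tau>: "0 < \<tau>"
    and X: "distributed M lborel X (normal_density 0 \<sigma>)"
    and W: "distributed M lborel W (normal_density 0 \<tau>)"
    and C: "has_copula M X W (gaussian_copula \<rho>)"
  shows "distr M borel (\<lambda>\<omega>. (X \<omega> / \<sigma>, W \<omega> / \<tau>)) = density lborel (bivariate_normal_density \<rho>)"
    (is "?L = ?R")
proof (rule finite_measure_eqI_atMost)
  note [measurable] = distributed_lborel_measurable[OF X] distributed_lborel_measurable[OF W]
  have XW[measurable]: "(\<lambda>\<omega>. (X \<omega> / \<sigma>, W \<omega> / \<tau>)) \<in> M \<rightarrow>\<^sub>M borel"
    unfolding borel_prod[symmetric] by measurable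
  interpret L: prob_space ?L by (rule prob_space_distr) (rule XW)
  show "finite_measure ?L" by (rule L.finite_measure_axioms)
  interpret N: prob_space std_normal_distribution by (rule prob_space_normal_density) simp
  interpret NN: pair_prob_space std_normal_distribution std_normal_distribution ..
  show "finite_measure ?R"
  proof -
    interpret R: prob_space ?R
      unfolding bivariate_normal_eq_distr[OF \<rho>]
      by (rule NN.prob_space_distr) (unfold borel_prod[symmetric], measurable)
    show ?thesis by (rule R.finite_measure_axioms)
  qed
  show "measure ?L {..p} = measure ?R {..p}" for p
  proof -
    obtain a b where p: "p = (a, b)" by fastforce
    have "measure ?L {..p} = prob ((\<lambda>\<omega>. (X \<omega> / \<sigma>, W \<omega> / \<tau>)) -` {..p} \<inter> space M)"
      by (rule measure_distr[OF XW]) simp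
    also have "(\<lambda>\<omega>. (X \<omega> / \<sigma>, W \<omega> / \<tau>)) -` {..p} \<inter> space M =
        {\<omega> \<in> space M. X \<omega> \<le> \<sigma> * a \<and> W \<omega> \<le> \<tau> * b}"
      using \<sigma> \<tau> by (auto simp: p field_simps)
    also have "prob \<dots> = gaussian_copula \<rho> (cdf (distr M borel X) (\<sigma> * a)) (cdf (distr M borel W) (\<tau> * b))"
      using C by (simp add: has_copula_def)
    also have "\<dots> = bivariate_normal_cdf \<rho> (ereal a) (ereal b)"
      using \<sigma> \<tau> by (simp add: cdf_normal[OF \<sigma> X] cdf_normal[OF \<tau> W] gaussian_copula_def std_normal_quantile_cdf)
    also have "\<dots> = measure ?R {..p}"
      unfolding bivariate_normal_cdf_def p by (rule arg_cong[where f="measure ?R"]) auto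
    finally show ?thesis .
  qed
qed simp_all

text \<open>The residual of the linear regression is obtained by inverting the map of
  \<open>bivariate_normal_eq_distr\<close>, which pulls the joint law back to a product of standard normal laws;
  that product form is the independence of the residual.\<close>
lemma gaussian_copula_regression:
  assumes \<rho>: "\<bar>\<rho>\<bar> < 1" and \<sigma>: "0 < \<sigma>" and \<tau>: "0 < \<tau>"
    and X: "distributed M lborel X (normal_density 0 \<sigma>)"
    and W: "distributed M lborel W (normal_density 0 \<tau>)"
    and C: "has_copula M X W (gaussian_copula \<rho>)"
  obtains Z where "indep_var borel W borel Z" "distributed M lborel Z std_normal_density"
    "\<And>\<omega>. X \<omega> = \<rho> * \<sigma> / \<tau> * W \<omega> + \<sigma> * sqrt (1 - \<rho>\<^sup>2) * Z \<omega>"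
proof
  let ?s = "sqrt (1 - \<rho>\<^sup>2)" let ?N = std_normal_distribution
  have s: "0 < ?s" using \<rho> by (simp add: abs_square_less_1)
  define U where "U = (\<lambda>\<omega>. W \<omega> / \<tau>)"
  define Z where "Z = (\<lambda>\<omega>. (X \<omega> / \<sigma> - \<rho> * U \<omega>) / ?s)"
  interpret N: prob_space ?N by (rule prob_space_normal_density) simp
  interpret NN: pair_prob_space ?N ?N ..
  note [measurable] = distributed_lborel_measurable[OF X] distributed_lborel_measurable[OF W]
  have U[measurable]: "random_variable borel U" unfolding U_def by measurable
  have Z[measurable]: "random_variable borel Z" unfolding Z_def by measurable
  have XW[measurable]: "(\<lambda>\<omega>. (X \<omega> / \<sigma>, U \<omega>)) \<in> M \<rightarrow>\<^sub>M borel"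
    unfolding borel_prod[symmetric] by measurable
  \<comment> \<open>the inverse of \<open>(u, z) \<mapsto> (\<rho> u + sqrt (1 - \<rho>\<^sup>2) z, u)\<close>\<close>
  define S where "S = (\<lambda>p::real \<times> real. (snd p, (fst p - \<rho> * snd p) / ?s))"
  have S[measurable]: "S \<in> borel \<rightarrow>\<^sub>M borel \<Otimes>\<^sub>M borel"
    unfolding S_def borel_prod
    using s by (intro borel_measurable_continuous_onI continuous_intros) auto
  have T[measurable]: "(\<lambda>(u, z). (\<rho> * u + ?s * z, u)) \<in> ?N \<Otimes>\<^sub>M ?N \<rightarrow>\<^sub>M borel"
    unfolding borel_prod[symmetric] by measurable
  have "distr M (borel \<Otimes>\<^sub>M borel) (\<lambda>\<omega>. (U \<omega>, Z \<omega>)) =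
      distr (distr M borel (\<lambda>\<omega>. (X \<omega> / \<sigma>, U \<omega>))) (borel \<Otimes>\<^sub>M borel) S"
    by (subst distr_distr[OF S XW]) (simp add: comp_def S_def Z_def)
  also have "\<dots> = distr (distr (?N \<Otimes>\<^sub>M ?N) borel (\<lambda>(u, z). (\<rho> * u + ?s * z, u))) (borel \<Otimes>\<^sub>M borel) S"
    unfolding U_def standardised_joint_distr[OF assms] bivariate_normal_eq_distr[OF \<rho>] ..
  also have "\<dots> = distr (?N \<Otimes>\<^sub>M ?N) (?N \<Otimes>\<^sub>M ?N) (\<lambda>p. p)"
  proof -
    have ST: "S \<circ> (\<lambda>(u, z). (\<rho> * u + ?s * z, u)) = (\<lambda>p. p)"
      using s by (auto simp: fun_eq_iff S_def)
    show ?thesis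
      unfolding distr_distr[OF S T] ST
      by (intro distr_cong refl sets_pair_measure_cong) simp_all
  qed
  finally have UZ: "distr M (borel \<Otimes>\<^sub>M borel) (\<lambda>\<omega>. (U \<omega>, Z \<omega>)) = ?N \<Otimes>\<^sub>M ?N"
    by (simp add: distr_id)
  have dU: "distr M borel U = ?N"
    unfolding U_def by (rule distributed_lborel_distr[OF distributed_normal_scaled[OF \<tau> W]])
  have "distr M borel Z = distr (distr M (borel \<Otimes>\<^sub>M borel) (\<lambda>\<omega>. (U \<omega>, Z \<omega>))) borel snd"
    by (subst distr_distr) (simp_all add: comp_def)
  also have "\<dots> = ?N"
    unfolding UZ
  proof (rule measure_eqI)
    fix A assume "A \<in> sets (distr (?N \<Otimes>\<^sub>M ?N) borel snd)"
    then have A: "A \<in> sets ?N" by simp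
    have "emeasure (distr (?N \<Otimes>\<^sub>M ?N) borel snd) A = emeasure (?N \<Otimes>\<^sub>M ?N) (UNIV \<times> A)"
      using A by (subst emeasure_distr) (auto intro!: arg_cong[where f="emeasure _"] simp: space_pair_measure)
    also have "\<dots> = emeasure ?N A"
      using A N.emeasure_space_1 by (subst N.emeasure_pair_measure_Times) simp_all
    finally show "emeasure (distr (?N \<Otimes>\<^sub>M ?N) borel snd) A = emeasure ?N A" .
  qed simp
  finally have dZ: "distr M borel Z = ?N" .
  have "distr M lborel Z = distr M borel Z" by (rule distr_cong) simp_all
  then show "distributed M lborel Z std_normal_density"
    using dZ Z by (simp add: distributed_def)
  have ind: "indep_var borel U borel Z"
    unfolding indep_var_distribution_eq UZ dU dZ by (intro conjI U Z refl)
  have "indep_var borel ((\<lambda>u. \<tau> * u) \<circ> U) borel ((\<lambda>z. z) \<circ> Z)"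
    by (rule indep_var_compose[OF ind]) simp_all
  moreover have "(\<lambda>u. \<tau> * u) \<circ> U = W" "(\<lambda>z. z) \<circ> Z = Z"
    using \<tau> by (auto simp: U_def)
  ultimately show "indep_var borel W borel Z" by metis
  show "X \<omega> = \<rho> * \<sigma> / \<tau> * W \<omega> + \<sigma> * ?s * Z \<omega>" for \<omega>
  proof -
    have "?s * Z \<omega> = X \<omega> / \<sigma> - \<rho> * U \<omega>" using s unfolding Z_def by simp
    then have "\<sigma> * ?s * Z \<omega> = \<sigma> * (X \<omega> / \<sigma> - \<rho> * U \<omega>)" unfolding mult.assoc by (rule arg_cong)
    also have "\<dots> = X \<omega> - \<rho> * \<sigma> / \<tau> * W \<omega>" using \<sigma> by (simp add: U_def right_diff_distrib)
    finally show ?thesis by linarith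
  qed
qed

text \<open>The coefficient \<open>a\<close> may vanish, in which case the first summand is constant and has no density;
  this happens here when \<open>\<phi> \<tau> + \<rho> \<sigma> = 0\<close>.\<close>
lemma normal_linear_combination:
  assumes ind: "indep_var borel W borel Z" and \<tau>: "0 < \<tau>" and b: "b \<noteq> 0"
    and W: "distributed M lborel W (normal_density 0 \<tau>)"
    and Z: "distributed M lborel Z std_normal_density"
  shows "distributed M lborel (\<lambda>\<omega>. a * W \<omega> + b * Z \<omega>) (normal_density 0 (sqrt ((a * \<tau>)\<^sup>2 + b\<^sup>2)))"
proof -
  have bZ: "distributed M lborel (\<lambda>\<omega>. b * Z \<omega>) (normal_density 0 \<bar>b\<bar>)"
    using normal_density_affine[OF Z _ b, of 0] by simp
  show ?thesis
  proof (cases "a = 0")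
    case True
    then show ?thesis using bZ by simp
  next
    case False
    have aW: "distributed M lborel (\<lambda>\<omega>. a * W \<omega>) (normal_density 0 (\<bar>a\<bar> * \<tau>))"
      using normal_density_affine[OF W \<tau> False, of 0] by simp
    have "indep_var borel (\<lambda>\<omega>. a * W \<omega>) borel (\<lambda>\<omega>. b * Z \<omega>)"
      using indep_var_compose[OF ind, of "\<lambda>u. a * u" borel "\<lambda>z. b * z" borel] by (simp add: comp_def)
    from add_indep_normal[OF this _ _ aW bZ] \<tau> b False show ?thesis
      by (simp add: power_mult_distrib)
  qed
qed

lemma normal_moments:
  assumes \<tau>: "0 < \<tau>" and X: "distributed M lborel X (normal_density 0 \<tau>)"
  shows "integrable M X" "expectation X = 0" "integrable M (\<lambda>\<omega>. (X \<omega>)\<^sup>2)"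
    "expectation (\<lambda>\<omega>. (X \<omega>)\<^sup>2) = \<tau>\<^sup>2"
proof -
  show "integrable M X"
    using distributed_integrable[OF X, of "\<lambda>x. x"] integrable_normal_moment_nz_1[OF \<tau>, of 0] by simp
  show "expectation X = 0"
    using normal_distributed_expectation[OF \<tau> X] .
  show "integrable M (\<lambda>\<omega>. (X \<omega>)\<^sup>2)"
    using distributed_integrable[OF X, of "\<lambda>x. x\<^sup>2"] integrable_normal_moment[OF \<tau>, of 0 2] by simp
  show "expectation (\<lambda>\<omega>. (X \<omega>)\<^sup>2) = \<tau>\<^sup>2"
    using normal_distributed_variance[OF \<tau> X] normal_distributed_expectation[OF \<tau> X] by simp
qed

section \<open>Conditional expectations and the Markov property\<close>

lemma integrable_mult_of_squares:
  fixes f g :: "'a \<Rightarrow> real"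
  assumes [measurable]: "f \<in> borel_measurable M" "g \<in> borel_measurable M"
    and "integrable M (\<lambda>\<omega>. (f \<omega>)\<^sup>2)" "integrable M (\<lambda>\<omega>. (g \<omega>)\<^sup>2)"
  shows "integrable M (\<lambda>\<omega>. f \<omega> * g \<omega>)"
proof (rule Bochner_Integration.integrable_bound)
  show "integrable M (\<lambda>\<omega>. (f \<omega>)\<^sup>2 + (g \<omega>)\<^sup>2)" using assms by simp
  show "AE \<omega> in M. norm (f \<omega> * g \<omega>) \<le> norm ((f \<omega>)\<^sup>2 + (g \<omega>)\<^sup>2)"
  proof (rule AE_I2)
    fix \<omega>
    have "2 * (\<bar>f \<omega>\<bar> * \<bar>g \<omega>\<bar>) \<le> (f \<omega>)\<^sup>2 + (g \<omega>)\<^sup>2"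
      using sum_squares_bound[of "\<bar>f \<omega>\<bar>" "\<bar>g \<omega>\<bar>"] by simp
    moreover have "0 \<le> \<bar>f \<omega>\<bar> * \<bar>g \<omega>\<bar>" by simp
    ultimately have "\<bar>f \<omega> * g \<omega>\<bar> \<le> (f \<omega>)\<^sup>2 + (g \<omega>)\<^sup>2"
      unfolding abs_mult by linarith
    then show "norm (f \<omega> * g \<omega>) \<le> norm ((f \<omega>)\<^sup>2 + (g \<omega>)\<^sup>2)"
      by simp
  qed
qed measurable

lemma subalgebra_vimage:
  "random_variable borel X \<Longrightarrow> subalgebra M (vimage_algebra (space M) X borel)"
  by (auto simp: subalgebra_def dest!: sets_image_in_sets[rotated])

text \<open>This is \<open>E[g W] = E[g E[W | F]] = E[g E[W | X]]\<close>, except that the Markov property speaks only of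
  indicators of events \<open>{W \<in> A}\<close>. Instead of extending it to \<open>W\<close> itself by approximation, move the
  conditioning to the other factor: with \<open>g' = E[g | X]\<close>, self-adjointness of conditional expectations
  turns the hypothesis on indicators into \<open>E[g; W \<in> A] = E[g'; W \<in> A]\<close> for all \<open>A\<close>, that is
  \<open>E[g - g' | W] = 0\<close>. Hence \<open>E[g W] = E[g' W] = E[g' E[W | X]] = c E[g' X] = c E[g X]\<close>. Square
  integrability makes all products integrable; \<open>g'\<close> inherits it by Jensen's inequality.\<close>
lemma expectation_mult_markov:
  fixes X W g :: "'a \<Rightarrow> real"
  defines "G \<equiv> vimage_algebra (space M) X borel"
  assumes F: "subalgebra M F"
    and X[measurable]: "random_variable borel X" and W[measurable]: "random_variable borel W"
    and gF[measurable]: "g \<in> borel_measurable F"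
    and g2: "integrable M (\<lambda>\<omega>. (g \<omega>)\<^sup>2)" and X2: "integrable M (\<lambda>\<omega>. (X \<omega>)\<^sup>2)"
    and W2: "integrable M (\<lambda>\<omega>. (W \<omega>)\<^sup>2)"
    and markov: "\<And>A. A \<in> sets borel \<Longrightarrow> AE \<omega> in M.
      real_cond_exp M F (indicator (W -` A \<inter> space M)) \<omega> =
      real_cond_exp M G (indicator (W -` A \<inter> space M)) \<omega>"
    and regression: "AE \<omega> in M. real_cond_exp M G W \<omega> = c * X \<omega>"
  shows "expectation (\<lambda>\<omega>. g \<omega> * W \<omega>) = c * expectation (\<lambda>\<omega>. g \<omega> * X \<omega>)"
proof -
  define H where "H = vimage_algebra (space M) W borel"
  interpret F: finite_measure_subalgebra M F by unfold_locales (rule F)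
  interpret G: finite_measure_subalgebra M G
    unfolding G_def by unfold_locales (rule subalgebra_vimage[OF X])
  interpret H: finite_measure_subalgebra M H
    unfolding H_def by unfold_locales (rule subalgebra_vimage[OF W])
  have g[measurable]: "g \<in> borel_measurable M" by (rule measurable_from_subalg[OF F gF])
  have XG[measurable]: "X \<in> borel_measurable G"
    unfolding G_def by (rule measurable_vimage_algebra1) simp
  have WH: "W \<in> borel_measurable H"
    unfolding H_def by (rule measurable_vimage_algebra1) simp
  have g1: "integrable M g" by (rule square_integrable_imp_integrable[OF g g2])
  define g' where "g' = real_cond_exp M G g"
  have g'G[measurable]: "g' \<in> borel_measurable G" and g'M[measurable]: "g' \<in> borel_measurable M"
    unfolding g'_def by measurable
  have g'1: "integrable M g'" unfolding g'_def by (rule G.real_cond_exp_int(1)[OF g1])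
  have g'2: "integrable M (\<lambda>\<omega>. (g' \<omega>)\<^sup>2)"
    unfolding g'_def
    by (rule G.integrable_convex_cond_exp[where I=UNIV, OF g1 _ _ g2]) (auto simp: convex_power2)
  have Xg: "integrable M (\<lambda>\<omega>. X \<omega> * g \<omega>)" by (rule integrable_mult_of_squares[OF X g X2 g2])
  have Wg: "integrable M (\<lambda>\<omega>. W \<omega> * g \<omega>)" by (rule integrable_mult_of_squares[OF W g W2 g2])
  have Wg': "integrable M (\<lambda>\<omega>. W \<omega> * g' \<omega>)" by (rule integrable_mult_of_squares[OF W g'M W2 g'2])
  have null: "AE \<omega> in M. real_cond_exp M H (\<lambda>\<omega>. g \<omega> - g' \<omega>) \<omega> = 0"
  proof (rule H.real_cond_exp_charact)
    fix A assume "A \<in> sets H"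
    then obtain B where B: "B \<in> sets borel" "A = W -` B \<inter> space M"
      by (auto simp: H_def sets_vimage_algebra2)
    then have A[measurable]: "A \<in> sets M" by simp
    let ?I = "indicator A :: 'a \<Rightarrow> real"
    have gI: "integrable M (\<lambda>\<omega>. g \<omega> * ?I \<omega>)" 
      using integrable_mult_indicator[OF A g1] by (simp add: mult.commute)
    have g'I: "integrable M (\<lambda>\<omega>. g' \<omega> * ?I \<omega>)" 
      using integrable_mult_indicator[OF A g'1] by (simp add: mult.commute)
    have FG: "AE \<omega> in M. g \<omega> * real_cond_exp M F ?I \<omega> = real_cond_exp M G ?I \<omega> * g \<omega>"
      using markov[OF B(1)] unfolding B(2)[symmetric] by eventually_elim simp
    have "integrable M (\<lambda>\<omega>. g \<omega> * real_cond_exp M F ?I \<omega>)"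
      by (rule F.real_cond_exp_intg(1)[OF gI]) measurable
    then have IG: "integrable M (\<lambda>\<omega>. real_cond_exp M G ?I \<omega> * g \<omega>)"
      by (rule integrable_cong_AE_imp[OF _ _ FG]) (intro borel_measurable_times borel_measurable_cond_exp2 g)
    have "(\<integral>\<omega>. g \<omega> * ?I \<omega> \<partial>M) = (\<integral>\<omega>. g \<omega> * real_cond_exp M F ?I \<omega> \<partial>M)"
      by (rule F.real_cond_exp_intg(2)[OF gI, symmetric]) measurable
    also have "\<dots> = (\<integral>\<omega>. real_cond_exp M G ?I \<omega> * g \<omega> \<partial>M)"
      by (rule integral_cong_AE[OF _ _ FG]) (intro borel_measurable_times borel_measurable_cond_exp2 g)+
    also have "\<dots> = (\<integral>\<omega>. real_cond_exp M G ?I \<omega> * g' \<omega> \<partial>M)"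
      unfolding g'_def by (rule G.real_cond_exp_intg(2)[OF IG, symmetric]) measurable
    also have "\<dots> = (\<integral>\<omega>. g' \<omega> * real_cond_exp M G ?I \<omega> \<partial>M)"
      by (simp add: mult.commute)
    also have "\<dots> = (\<integral>\<omega>. g' \<omega> * ?I \<omega> \<partial>M)"
      by (rule G.real_cond_exp_intg(2)[OF g'I]) measurable
    finally show "(\<integral>\<omega>\<in>A. (g \<omega> - g' \<omega>) \<partial>M) = (\<integral>\<omega>\<in>A. 0 \<partial>M)"
      using gI g'I by (simp add: set_lebesgue_integral_def right_diff_distrib mult.commute)
  qed (use g1 g'1 in auto)
  have diff: "integrable M (\<lambda>\<omega>. W \<omega> * (g \<omega> - g' \<omega>))"
    using Wg Wg' by (simp add: right_diff_distrib)
  have "(\<integral>\<omega>. W \<omega> * (g \<omega> - g' \<omega>) \<partial>M) =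
      (\<integral>\<omega>. W \<omega> * real_cond_exp M H (\<lambda>\<omega>. g \<omega> - g' \<omega>) \<omega> \<partial>M)"
    by (rule H.real_cond_exp_intg(2)[OF diff WH, symmetric]) measurable
  also have "\<dots> = (\<integral>\<omega>. 0 \<partial>M)"
    by (rule integral_cong_AE) (use null in \<open>auto elim!: eventually_mono\<close>)
  finally have "expectation (\<lambda>\<omega>. W \<omega> * g \<omega>) = expectation (\<lambda>\<omega>. W \<omega> * g' \<omega>)"
    using Wg Wg' by (simp add: right_diff_distrib)
  also have "\<dots> = expectation (\<lambda>\<omega>. g' \<omega> * W \<omega>)" by (simp add: mult.commute)
  also have "\<dots> = expectation (\<lambda>\<omega>. g' \<omega> * real_cond_exp M G W \<omega>)"
    by (rule G.real_cond_exp_intg(2)[symmetric]) (use Wg' in \<open>simp_all add: mult.commute\<close>)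
  also have "\<dots> = expectation (\<lambda>\<omega>. c * (X \<omega> * g' \<omega>))"
    by (rule integral_cong_AE) (use regression in \<open>auto elim!: eventually_mono\<close>)
  also have "\<dots> = c * expectation (\<lambda>\<omega>. X \<omega> * g' \<omega>)" by simp
  also have "expectation (\<lambda>\<omega>. X \<omega> * g' \<omega>) = expectation (\<lambda>\<omega>. X \<omega> * g \<omega>)"
    unfolding g'_def by (rule G.real_cond_exp_intg(2)[OF Xg]) measurable
  finally show ?thesis by (simp add: mult.commute)
qed

text \<open>An independent centred error integrates to zero over every event that depends on \<open>X\<close> only.\<close>
lemma real_cond_exp_linear_regression:
  assumes ind: "indep_var borel X borel Z"
    and X: "integrable M X" and Z: "integrable M Z" "expectation Z = 0"
    and W: "AE \<omega> in M. W \<omega> = c * X \<omega> + b * Z \<omega>" and Wm[measurable]: "random_variable borel W"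
  shows "AE \<omega> in M. real_cond_exp M (vimage_algebra (space M) X borel) W \<omega> = c * X \<omega>"
proof -
  let ?G = "vimage_algebra (space M) X borel"
  have Xm[measurable]: "random_variable borel X" using X by auto
  interpret G: finite_measure_subalgebra M ?G
    by unfold_locales (rule subalgebra_vimage[OF Xm])
  have XG[measurable]: "X \<in> borel_measurable ?G"
    by (rule measurable_vimage_algebra1) simp
  have Zm[measurable]: "random_variable borel Z" using Z by auto
  show ?thesis
  proof (rule G.real_cond_exp_charact)
    fix A assume "A \<in> sets ?G"
    then obtain B where B[measurable]: "B \<in> sets borel" and A: "A = X -` B \<inter> space M"
      by (auto simp: sets_vimage_algebra2)
    have Am[measurable]: "A \<in> sets M" unfolding A by simp
    have indB: "indep_var borel (\<lambda>\<omega>. indicator B (X \<omega>) :: real) borel Z"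
      using indep_var_compose[OF ind borel_measurable_indicator[OF B] measurable_ident]
      by (simp only: comp_def id_def)
    have iB: "integrable M (\<lambda>\<omega>. indicator B (X \<omega>) :: real)"
      by (rule integrable_const_bound[where B=1]) auto
    have IX: "integrable M (\<lambda>\<omega>. indicator A \<omega> * X \<omega>)"
      using integrable_mult_indicator[OF Am X] by simp
    have IZ: "integrable M (\<lambda>\<omega>. indicator A \<omega> * Z \<omega>)"
      using integrable_mult_indicator[OF Am Z(1)] by simp
    have "(\<integral>\<omega>. indicator A \<omega> * Z \<omega> \<partial>M) = (\<integral>\<omega>. indicator B (X \<omega>) * Z \<omega> \<partial>M)"
      by (rule Bochner_Integration.integral_cong) (auto simp: A indicator_def)
    also have "\<dots> = 0"
      using indep_var_lebesgue_integral[OF indB iB Z(1)] Z(2) by simp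
    finally have 0: "(\<integral>\<omega>. indicator A \<omega> * Z \<omega> \<partial>M) = 0" .
    have "(\<integral>\<omega>. indicator A \<omega> * W \<omega> \<partial>M) =
        (\<integral>\<omega>. c * (indicator A \<omega> * X \<omega>) + b * (indicator A \<omega> * Z \<omega>) \<partial>M)"
      by (rule integral_cong_AE) (measurable, use W in eventually_elim, simp add: algebra_simps)
    also have "\<dots> = c * (\<integral>\<omega>. indicator A \<omega> * X \<omega> \<partial>M)"
      using IX IZ 0 by simp
    finally show "(\<integral>\<omega>\<in>A. W \<omega> \<partial>M) = (\<integral>\<omega>\<in>A. c * X \<omega> \<partial>M)"
      using IX by (simp add: set_lebesgue_integral_def mult.left_commute)
  next
    have "integrable M (\<lambda>\<omega>. c * X \<omega> + b * Z \<omega>)" using X Z by simp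
    then show "integrable M W"
      by (rule integrable_cong_AE_imp) (measurable, use W in eventually_elim, simp)
  qed (use X in auto)
qed

end

lemma subalgebra_own_filtration:
  assumes "\<And>s. Y s \<in> borel_measurable M"
  shows "subalgebra M (own_filtration M Y t)"
  unfolding subalgebra_def own_filtration_def
  using assms by (auto intro!: sets.sigma_sets_subset simp: sets_measure_of_conv space_measure_of_conv measurable_sets)

lemma measurable_own_filtration:
  assumes "s \<le> t"
  shows "Y s \<in> borel_measurable (own_filtration M Y t)"
proof (rule measurableI)
  fix A :: "real set" assume "A \<in> sets borel"
  then show "Y s -` A \<inter> space (own_filtration M Y t) \<in> sets (own_filtration M Y t)"
    using assms unfolding own_filtration_def
    by (subst sets_measure_of) (auto simp: space_measure_of_conv intro!: sigma_sets.Basic)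
qed simp

section \<open>The recursion for the standard deviation\<close>

text \<open>The standard deviation of \<open>\<phi> W + X\<close> when \<open>W\<close> has standard deviation \<open>v\<close>, \<open>X\<close> has standard deviation
  \<open>\<sigma>\<close>, and their correlation is \<open>\<rho>\<close>. The two squares are the variances of the part explained by
  \<open>W\<close> and of the residual; this form exhibits positivity and the Lipschitz constant.\<close>
definition next_sd :: "real \<Rightarrow> real \<Rightarrow> real \<Rightarrow> real \<Rightarrow> real" where
  "next_sd \<phi> \<rho> \<sigma> v = sqrt ((\<phi> * v + \<rho> * \<sigma>)\<^sup>2 + (\<sigma> * sqrt (1 - \<rho>\<^sup>2))\<^sup>2)"

lemma next_sd_pos:
  assumes "\<bar>\<rho>\<bar> < 1" "0 < \<sigma>"
  shows "0 < next_sd \<phi> \<rho> \<sigma> v"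
proof -
  have "0 < \<sigma> * sqrt (1 - \<rho>\<^sup>2)" using assms by (simp add: abs_square_less_1)
  then show ?thesis
    unfolding next_sd_def by (intro real_sqrt_gt_zero add_nonneg_pos zero_le_power2 zero_less_power)
qed

text \<open>\<open>next_sd \<phi> \<rho> \<sigma> v\<close> is the modulus of a complex number whose imaginary part does not depend on \<open>v\<close>
  and whose real part has slope \<open>\<phi>\<close> in \<open>v\<close>, so the reverse triangle inequality applies.\<close>
lemma next_sd_lipschitz: "\<bar>next_sd \<phi> \<rho> \<sigma> v - next_sd \<phi> \<rho> \<sigma> w\<bar> \<le> \<bar>\<phi>\<bar> * \<bar>v - w\<bar>"
proof -
  let ?p = "\<lambda>v. Complex (\<phi> * v + \<rho> * \<sigma>) (\<sigma> * sqrt (1 - \<rho>\<^sup>2))"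
  have norm: "next_sd \<phi> \<rho> \<sigma> v = cmod (?p v)" for v by (simp add: next_sd_def cmod_def)
  have "?p v - ?p w = complex_of_real (\<phi> * (v - w))"
    by (simp add: complex_eq_iff algebra_simps)
  then have "cmod (?p v - ?p w) = \<bar>\<phi>\<bar> * \<bar>v - w\<bar>" by (simp only: norm_of_real abs_mult)
  then show ?thesis unfolding norm using norm_triangle_ineq3[of "?p v" "?p w"] by simp
qed

lemma V_bar_pos:
  assumes "\<bar>\<phi>\<bar> < 1" "0 < \<sigma>"
  shows "0 < V_bar \<sigma> \<rho> \<phi>"
proof -
  have r: "0 < 1 - \<phi>\<^sup>2" using assms by (simp add: abs_square_less_1)
  then have "sqrt ((\<rho> * \<phi>)\<^sup>2) < sqrt (\<rho>\<^sup>2 * \<phi>\<^sup>2 + 1 - \<phi>\<^sup>2)"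
    by (intro real_sqrt_less_mono) (simp add: power_mult_distrib)
  then have "0 < \<rho> * \<phi> + sqrt (\<rho>\<^sup>2 * \<phi>\<^sup>2 + 1 - \<phi>\<^sup>2)" unfolding real_sqrt_abs by linarith
  then show ?thesis unfolding V_bar_def using r assms by simp
qed

text \<open>\<open>V_bar \<sigma> \<rho> \<phi>\<close> is the positive root of the quadratic equation
  \<open>(1 - \<phi>\<^sup>2) V\<^sup>2 = 2 \<phi> \<rho> \<sigma> V + \<sigma>\<^sup>2\<close>, which is the squared fixed-point equation.\<close>
lemma next_sd_V_bar:
  assumes \<phi>: "\<bar>\<phi>\<bar> < 1" and \<rho>: "\<bar>\<rho>\<bar> < 1" and \<sigma>: "0 < \<sigma>"
  shows "next_sd \<phi> \<rho> \<sigma> (V_bar \<sigma> \<rho> \<phi>) = V_bar \<sigma> \<rho> \<phi>"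
proof -
  define V where "V = V_bar \<sigma> \<rho> \<phi>"
  define r where "r = 1 - \<phi>\<^sup>2"
  define D where "D = sqrt (\<rho>\<^sup>2 * \<phi>\<^sup>2 + 1 - \<phi>\<^sup>2)"
  have r: "0 < r" using \<phi> by (simp add: abs_square_less_1 r_def)
  have D2: "D\<^sup>2 = \<rho>\<^sup>2 * \<phi>\<^sup>2 + r"
  proof -
    have "\<rho>\<^sup>2 * \<phi>\<^sup>2 + 1 - \<phi>\<^sup>2 = \<rho>\<^sup>2 * \<phi>\<^sup>2 + r" by (simp add: r_def)
    moreover have "0 \<le> \<rho>\<^sup>2 * \<phi>\<^sup>2 + r" using r by simp
    ultimately show ?thesis unfolding D_def by simp
  qed
  have "r * V = \<sigma> * (\<rho> * \<phi> + D)"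
    using r unfolding V_def V_bar_def r_def[symmetric] D_def[symmetric] by simp
  then have "r * V - \<sigma> * \<rho> * \<phi> = \<sigma> * D"
    by (simp add: algebra_simps)
  then have "(r * V - \<sigma> * \<rho> * \<phi>)\<^sup>2 = \<sigma>\<^sup>2 * (\<rho>\<^sup>2 * \<phi>\<^sup>2 + r)"
    by (simp add: power_mult_distrib D2)
  then have "r * (r * V\<^sup>2) = r * (2 * \<phi> * \<rho> * \<sigma> * V + \<sigma>\<^sup>2)"
    by (simp add: power2_eq_square algebra_simps)
  then have "r * V\<^sup>2 = 2 * \<phi> * \<rho> * \<sigma> * V + \<sigma>\<^sup>2" using r by simp
  moreover have "(\<sigma> * sqrt (1 - \<rho>\<^sup>2))\<^sup>2 = \<sigma>\<^sup>2 * (1 - \<rho>\<^sup>2)"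
    using \<rho> by (simp add: power_mult_distrib abs_square_le_1 less_imp_le)
  ultimately have "(\<phi> * V + \<rho> * \<sigma>)\<^sup>2 + (\<sigma> * sqrt (1 - \<rho>\<^sup>2))\<^sup>2 = V\<^sup>2"
    by (simp add: r_def power2_eq_square algebra_simps)
  then show ?thesis
    using V_bar_pos[OF \<phi> \<sigma>, of \<rho>] by (simp add: next_sd_def V_def[symmetric])
qed

lemma next_sd_iterates_tendsto:
  assumes \<phi>: "\<bar>\<phi>\<bar> < 1" and \<rho>: "\<bar>\<rho>\<bar> < 1" and \<sigma>: "0 < \<sigma>"
  shows "(\<lambda>n. (next_sd \<phi> \<rho> \<sigma> ^^ n) v) \<longlonglongrightarrow> V_bar \<sigma> \<rho> \<phi>"
proof -
  let ?V = "V_bar \<sigma> \<rho> \<phi>"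
  have bound: "norm ((next_sd \<phi> \<rho> \<sigma> ^^ n) v - ?V) \<le> \<bar>\<phi>\<bar> ^ n * \<bar>v - ?V\<bar>" for n
  proof (induction n)
    case (Suc n)
    have "\<bar>(next_sd \<phi> \<rho> \<sigma> ^^ Suc n) v - ?V\<bar> \<le> \<bar>\<phi>\<bar> * \<bar>(next_sd \<phi> \<rho> \<sigma> ^^ n) v - ?V\<bar>"
      using next_sd_lipschitz[of \<phi> \<rho> \<sigma> "(next_sd \<phi> \<rho> \<sigma> ^^ n) v" ?V]
      by (simp add: next_sd_V_bar[OF assms])
    also have "\<dots> \<le> \<bar>\<phi>\<bar> * (\<bar>\<phi>\<bar> ^ n * \<bar>v - ?V\<bar>)"
      using Suc.IH by (intro mult_left_mono) simp_all
    finally show ?case by (simp add: mult.assoc)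
  qed simp
  have "(\<lambda>n. \<bar>\<phi>\<bar> ^ n * \<bar>v - ?V\<bar>) \<longlonglongrightarrow> 0"
    using \<phi> by (intro tendsto_mult_left_zero LIMSEQ_power_zero) simp
  then have "(\<lambda>n. (next_sd \<phi> \<rho> \<sigma> ^^ n) v - ?V) \<longlonglongrightarrow> 0"
    by (rule Lim_null_comparison[OF always_eventually[OF allI[OF bound]]])
  then show ?thesis by (simp add: LIM_zero_iff)
qed

section \<open>Moments and autocorrelations of the process\<close>

lemma (in prob_space) distributed_lborel_cong_AE:
  assumes X: "distributed M lborel X f" and X'[measurable]: "random_variable borel X'"
    and eq: "AE \<omega> in M. X \<omega> = X' \<omega>"
  shows "distributed M lborel X' f"
proof -
  have [measurable]: "random_variable borel X" by (rule distributed_lborel_measurable[OF X])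
  have "distr M lborel X = distr M lborel X'"
    by (rule distr_cong_AE) (use eq in simp_all)
  then show ?thesis using X by (simp add: distributed_def)
qed

context dig_ar1
begin

text \<open>The standard deviation of \<open>Y\<close> at time \<open>n + 1\<close>: the recursion starts at time \<open>1\<close>, where \<open>Y\<close> is the first
  innovation, because \<open>Y\<close> is degenerate at time \<open>0\<close>.\<close>
abbreviation sd :: "nat \<Rightarrow> real" where
  "sd n \<equiv> (next_sd \<phi> \<rho> \<sigma> ^^ n) \<sigma>"

lemma sd_pos: "0 < sd n"
  using next_sd_pos[OF abs_rho_less_1 sigma_pos] sigma_pos by (cases n) simp_all

text \<open>By the regression of the innovation on the current state, the next state is
  \<open>(\<phi> + \<rho> \<sigma> / \<tau>) Y\<^bsub>t\<^esub>\<close> plus an independent centred normal residual.\<close>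
lemma transition:
  assumes \<tau>: "0 < \<tau>" and Y: "distributed M lborel (Y t) (normal_density 0 \<tau>)"
  shows "distributed M lborel (Y (Suc t)) (normal_density 0 (next_sd \<phi> \<rho> \<sigma> \<tau>))"
    and "AE \<omega> in M. real_cond_exp M (vimage_algebra (space M) (Y t) borel) (Y (Suc t)) \<omega> =
      (\<phi> + \<rho> * \<sigma> / \<tau>) * Y t \<omega>"
proof -
  let ?b = "\<sigma> * sqrt (1 - \<rho>\<^sup>2)" and ?c = "\<phi> + \<rho> * \<sigma> / \<tau>"
  have b: "?b \<noteq> 0" using sigma_pos abs_rho_less_1 by (simp add: abs_square_eq_1)
  have \<xi>: "distributed M lborel (\<xi> (Suc t)) (normal_density 0 \<sigma>)" by (rule innovation_distr) simp
  have C: "has_copula M (\<xi> (Suc t)) (Y t) (gaussian_copula \<rho>)"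
    using innovation_copula[of "Suc t"] by simp
  obtain Z where ind: "indep_var borel (Y t) borel Z"
    and Z: "distributed M lborel Z std_normal_density"
    and reg: "\<And>\<omega>. \<xi> (Suc t) \<omega> = \<rho> * \<sigma> / \<tau> * Y t \<omega> + ?b * Z \<omega>"
    by (rule gaussian_copula_regression[OF abs_rho_less_1 sigma_pos \<tau> \<xi> Y C]) blast
  have eq: "AE \<omega> in M. Y (Suc t) \<omega> = ?c * Y t \<omega> + ?b * Z \<omega>"
    using Y_rec[of "Suc t"] by (simp add: reg distrib_right add.assoc)
  have "(?c * \<tau>)\<^sup>2 = (\<phi> * \<tau> + \<rho> * \<sigma>)\<^sup>2" using \<tau> by (simp add: distrib_right)
  then have "distributed M lborel (\<lambda>\<omega>. ?c * Y t \<omega> + ?b * Z \<omega>) (normal_density 0 (next_sd \<phi> \<rho> \<sigma> \<tau>))"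
    using normal_linear_combination[OF ind \<tau> b Y Z, of ?c] by (simp only: next_sd_def)
  then show "distributed M lborel (Y (Suc t)) (normal_density 0 (next_sd \<phi> \<rho> \<sigma> \<tau>))"
    by (rule distributed_lborel_cong_AE[OF _ random_variable_Y]) (use eq in eventually_elim, simp)
  show "AE \<omega> in M. real_cond_exp M (vimage_algebra (space M) (Y t) borel) (Y (Suc t)) \<omega> = ?c * Y t \<omega>"
    by (rule real_cond_exp_linear_regression[OF ind normal_moments(1)[OF \<tau> Y]
          normal_moments(1,2)[OF zero_less_one Z] eq random_variable_Y])
qed

lemma Y_distr: "distributed M lborel (Y (Suc n)) (normal_density 0 (sd n))"
proof (induction n)
  case 0
  have "AE \<omega> in M. \<xi> 1 \<omega> = Y 1 \<omega>" using Y_rec[OF order_refl] Y_0 by eventually_elim simp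
  then have "distributed M lborel (Y 1) (normal_density 0 \<sigma>)"
    by (rule distributed_lborel_cong_AE[OF innovation_distr[OF order_refl] random_variable_Y])
  then show ?case by simp
next
  case (Suc n)
  from transition(1)[OF sd_pos Suc] show ?case by simp
qed

lemmas Y_moments = normal_moments[OF sd_pos Y_distr]

end

context markov_dig_ar1
begin

text \<open>Each further time step contributes its regression coefficient: \<open>expectation_mult_markov\<close> is used
  with the earlier variable as the factor that is measurable with respect to the past.\<close>
lemma expectation_product:
  "expectation (\<lambda>\<omega>. Y (Suc n) \<omega> * Y (Suc n + k) \<omega>) =
    (\<Prod>i<k. \<phi> + \<rho> * \<sigma> / sd (n + i)) * (sd n)\<^sup>2"
proof (induction k)
  case 0
  show ?case using Y_moments(4)[of n] by (simp add: power2_eq_square)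
next
  case (Suc k)
  let ?s = "Suc (n + k)"
  have "expectation (\<lambda>\<omega>. Y (Suc n) \<omega> * Y (Suc ?s) \<omega>) =
      (\<phi> + \<rho> * \<sigma> / sd (n + k)) * expectation (\<lambda>\<omega>. Y (Suc n) \<omega> * Y ?s \<omega>)"
  proof (rule expectation_mult_markov)
    show "subalgebra M (own_filtration M Y ?s)"
      by (rule subalgebra_own_filtration) (rule random_variable_Y)
    show "Y (Suc n) \<in> borel_measurable (own_filtration M Y ?s)"
      by (rule measurable_own_filtration) simp
    show "AE \<omega> in M. real_cond_exp M (own_filtration M Y ?s) (indicator (Y (Suc ?s) -` A \<inter> space M)) \<omega> =
        real_cond_exp M (vimage_algebra (space M) (Y ?s) borel) (indicator (Y (Suc ?s) -` A \<inter> space M)) \<omega>"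
      if "A \<in> sets borel" for A
      using markov that unfolding markov_process_def by simp
    show "AE \<omega> in M. real_cond_exp M (vimage_algebra (space M) (Y ?s) borel) (Y (Suc ?s)) \<omega> =
        (\<phi> + \<rho> * \<sigma> / sd (n + k)) * Y ?s \<omega>"
      by (rule transition(2)[OF sd_pos Y_distr])
  qed (rule random_variable_Y Y_moments(3))+
  then show ?case using Suc by simp
qed

lemma correlation_Y:
  "correlation (Y (Suc n)) (Y (Suc n + k)) =
    (\<Prod>i<k. \<phi> + \<rho> * \<sigma> / sd (n + i)) * (sd n / sd (n + k))"
proof -
  have "covariance (Y (Suc n)) (Y (Suc n + k)) =
      (\<Prod>i<k. \<phi> + \<rho> * \<sigma> / sd (n + i)) * (sd n)\<^sup>2"
    unfolding covariance_def using expectation_product[of n k] Y_moments(2) by simp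
  moreover have "sqrt (variance (Y (Suc m))) = sd m" for m
    using Y_moments(2,4)[of m] sd_pos[of m] by simp
  ultimately show ?thesis
    unfolding correlation_def using sd_pos[of n] sd_pos[of "n + k"]
    by (simp add: power2_eq_square)
qed

lemma correlation_tendsto:
  "(\<lambda>t. correlation (Y t) (Y (t + k))) \<longlonglongrightarrow> (\<phi> + \<rho> * \<sigma> / V_bar \<sigma> \<rho> \<phi>) ^ k"
proof -
  let ?V = "V_bar \<sigma> \<rho> \<phi>"
  have V: "?V \<noteq> 0" using V_bar_pos[OF abs_phi_less_1 sigma_pos, of \<rho>] by simp
  have sd: "(\<lambda>n. sd (n + i)) \<longlonglongrightarrow> ?V" for i
    by (rule LIMSEQ_ignore_initial_segment)
      (rule next_sd_iterates_tendsto[OF abs_phi_less_1 abs_rho_less_1 sigma_pos])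
  have "(\<lambda>n. (\<Prod>i<k. \<phi> + \<rho> * \<sigma> / sd (n + i)) * (sd (n + 0) / sd (n + k)))
      \<longlonglongrightarrow> (\<Prod>i<k. \<phi> + \<rho> * \<sigma> / ?V) * (?V / ?V)"
    by (intro tendsto_intros sd V)
  then have "(\<lambda>n. correlation (Y (Suc n)) (Y (Suc n + k))) \<longlonglongrightarrow> (\<phi> + \<rho> * \<sigma> / ?V) ^ k"
    unfolding correlation_Y using V by simp
  then show ?thesis by (rule LIMSEQ_imp_Suc)
qed

end

theorem proposition3p1:
  fixes M :: "'a measure" and \<phi> \<rho> \<sigma> :: real and Y \<xi> :: "nat \<Rightarrow> 'a \<Rightarrow> real" and k :: nat
  assumes "\<bar>\<phi>\<bar> < 1" and "\<bar>\<rho>\<bar> < 1" and "\<sigma> > 0"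
    and "markov_dig_ar1 M \<phi> \<rho> \<sigma> Y \<xi>"
    and "k \<ge> 1"
  shows "(\<lambda>t. prob_space.correlation M (Y t) (Y (t + k)))
           \<longlonglongrightarrow> (\<phi> + \<rho> * \<sigma> / V_bar \<sigma> \<rho> \<phi>) ^ k"
  using markov_dig_ar1.correlation_tendsto[OF assms(4)] .

end
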